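(* For every voting rule $\mathcal{E}$, $\mathcal{E}$-Conformant Manipulation polynomial-time many-one reduces to $\mathcal{E}$-Exact Control by Adding Voters.
   Context: An election $(C,V)$ consists of a finite set of candidates $C$ and a finite collection (multiset, listed explicitly) of voters $V$; each voter has a vote, which is a strict total order over $C$. A voting rule $\mathcal{E}$ maps each election to a subset of its candidate set, the $\mathcal{E}$-winners. $\mathcal{E}$-Conformant Manipulation is the following decision problem. Given: an election $(C,V)$, a collection of manipulative voters $W$ (listed explicitly, votes not yet set), and a preferred candidate $p\in C$. Question: does there exist a way to set the votes of the manipulators in $W$ using only votes that occur in $V$ (a vote may be used by any number of manipulators; every manipulator must cast a vote) such that $p$ is an $\mathcal{E}$-winner of the election $(C,V\cup W)$? $\mathcal{E}$-Exact Control by Adding Voters is the following decision problem. Given: an election $(C,V)$ ($V$ are the registered voters), a collection $U$ of unregistered voters with votes over $C$, an integer $k\ge 0$, and a preferred candidate $p\in C$. Question: does there exist a subcollection $U'\subseteq U$ of size exactly $k$ such that $p$ is an $\mathcal{E}$-winner of $(C,V\cup U')$? *)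

theory Defs
  imports "HOL-Library.Multiset" "HOL-Computational_Algebra.Polynomial"
begin

section \<open>Deterministic multi-tape Turing machines\<close>

datatype 'a cell = Blank | Letter 'a | Aux nat

datatype move = MoveLeft | Stay | MoveRight

text \<open>A transition maps a state and the list of scanned cells (one per tape) to a new state and,
  for each tape, the cell to be written and the head movement.\<close>

record 'a tm =
  tm_tapes :: nat
  tm_states :: "nat set"
  tm_start :: nat
  tm_halt :: nat
  tm_alphabet :: "'a cell set"
  tm_delta :: "nat \<Rightarrow> 'a cell list \<Rightarrow> nat \<times> ('a cell \<times> move) list"

definition wf_tm :: "'a tm \<Rightarrow> bool" where
  "wf_tm M \<longleftrightarrow>
     tm_tapes M \<ge> 1 \<and>
     finite (tm_states M) \<and> tm_start M \<in> tm_states M \<and> tm_halt M \<in> tm_states M \<and>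
     finite (tm_alphabet M) \<and> insert Blank (range Letter) \<subseteq> tm_alphabet M \<and>
     (\<forall>q \<in> tm_states M - {tm_halt M}. \<forall>cs \<in> lists (tm_alphabet M). length cs = tm_tapes M \<longrightarrow>
        fst (tm_delta M q cs) \<in> tm_states M \<and>
        length (snd (tm_delta M q cs)) = tm_tapes M \<and>
        fst ` set (snd (tm_delta M q cs)) \<subseteq> tm_alphabet M)"

text \<open>A tape is infinite in both directions and is given by its content and its head position.\<close>

type_synonym 'a tape = "(int \<Rightarrow> 'a cell) \<times> int"

type_synonym 'a config = "nat \<times> 'a tape list"

fun scan :: "'a tape \<Rightarrow> 'a cell" where
  "scan (t, i) = t i"

fun offset :: "move \<Rightarrow> int" where
  "offset MoveLeft = - 1"
| "offset Stay = 0"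
| "offset MoveRight = 1"

fun act :: "'a cell \<times> move \<Rightarrow> 'a tape \<Rightarrow> 'a tape" where
  "act (c, d) (t, i) = (t(i := c), i + offset d)"

fun step :: "'a tm \<Rightarrow> 'a config \<Rightarrow> 'a config" where
  "step M (q, ts) =
     (if q = tm_halt M then (q, ts)
      else (case tm_delta M q (map scan ts) of (q', as) \<Rightarrow> (q', map2 act as ts)))"

definition word_content :: "'a list \<Rightarrow> int \<Rightarrow> 'a cell" where
  "word_content x i = (if 0 \<le> i \<and> i < int (length x) then Letter (x ! nat i) else Blank)"

text \<open>The input is on the first tape, the output on the last one.\<close>

definition init_config :: "'a tm \<Rightarrow> 'a list \<Rightarrow> 'a config" where
  "init_config M x =
     (tm_start M, (word_content x, 0) # replicate (tm_tapes M - 1) (word_content [], 0))"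

definition outputs_within :: "'a tm \<Rightarrow> 'a list \<Rightarrow> 'a list \<Rightarrow> nat \<Rightarrow> bool" where
  "outputs_within M x y n \<longleftrightarrow>
     (\<exists>t \<le> n. case (step M ^^ t) (init_config M x) of (q, ts) \<Rightarrow>
        q = tm_halt M \<and> fst (last ts) = word_content y)"

definition poly_time_computable :: "('a list \<Rightarrow> 'a list) \<Rightarrow> bool" where
  "poly_time_computable f \<longleftrightarrow>
     (\<exists>(M :: 'a tm) (b :: nat poly). wf_tm M \<and>
        (\<forall>x. outputs_within M x (f x) (poly b (length x))))"

definition poly_time_reducible :: "'a list set \<Rightarrow> 'a list set \<Rightarrow> bool" (infix "\<le>\<^sub>p" 50) where
  "A \<le>\<^sub>p B \<longleftrightarrow> (\<exists>f. poly_time_computable f \<and> (\<forall>x. x \<in> A \<longleftrightarrow> f x \<in> B))"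


section \<open>Elections and voting rules\<close>

text \<open>A pair \<open>(a, b)\<close> in a vote means that \<open>a\<close> is preferred to \<open>b\<close>. The predicate
  \<open>strict_linear_order_on\<close> alone does not confine the relation to \<open>C\<close>.\<close>

definition votes_over :: "'c set \<Rightarrow> 'c rel set" where
  "votes_over C = {v. v \<subseteq> C \<times> C \<and> strict_linear_order_on C v}"

definition election :: "'c set \<Rightarrow> 'c rel multiset \<Rightarrow> bool" where
  "election C V \<longleftrightarrow> finite C \<and> set_mset V \<subseteq> votes_over C"

definition voting_rule :: "('c set \<Rightarrow> 'c rel multiset \<Rightarrow> 'c set) \<Rightarrow> bool" where
  "voting_rule E \<longleftrightarrow> (\<forall>C V. election C V \<longrightarrow> E C V \<subseteq> C)"

text \<open>The manipulators are numbered \<open>0, \<dots>, m - 1\<close>, and \<open>w i\<close> is the vote cast by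
  manipulator \<open>i\<close>.\<close>

definition conformant_manipulation ::
  "('c set \<Rightarrow> 'c rel multiset \<Rightarrow> 'c set) \<Rightarrow> 'c set \<Rightarrow> 'c rel multiset \<Rightarrow> nat \<Rightarrow> 'c \<Rightarrow> bool" where
  "conformant_manipulation E C V m p \<longleftrightarrow>
     (\<exists>w :: nat \<Rightarrow> 'c rel. (\<forall>i < m. w i \<in># V) \<and> p \<in> E C (V + image_mset w (mset [0..<m])))"

definition exact_control_adding_voters ::
  "('c set \<Rightarrow> 'c rel multiset \<Rightarrow> 'c set) \<Rightarrow>
     'c set \<Rightarrow> 'c rel multiset \<Rightarrow> 'c rel multiset \<Rightarrow> nat \<Rightarrow> 'c \<Rightarrow> bool" where
  "exact_control_adding_voters E C V U k p \<longleftrightarrow>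
     (\<exists>U'. U' \<subseteq># U \<and> size U' = k \<and> p \<in> E C (V + U'))"


section \<open>The decision problems as languages\<close>

text \<open>In an instance a vote is written as the list of all candidates, most preferred first.\<close>

definition ranking :: "'c list \<Rightarrow> 'c rel" where
  "ranking xs = {(xs ! i, xs ! j) | i j. i < j \<and> j < length xs}"

lemma ranking_Cons: "ranking (x # xs) = {x} \<times> set xs \<union> ranking xs"
proof (intro set_eqI iffI)
  fix z assume "z \<in> ranking (x # xs)"
  then obtain i j where ij: "z = ((x # xs) ! i, (x # xs) ! j)" "i < j" "j < length (x # xs)"
    unfolding ranking_def by blast
  then obtain j' where j: "j = Suc j'" by (cases j) auto
  show "z \<in> {x} \<times> set xs \<union> ranking xs"
    using ij j unfolding ranking_def by (cases i) auto
next
  fix z assume "z \<in> {x} \<times> set xs \<union> ranking xs"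
  then consider y where "z = (x, y)" "y \<in> set xs" | "z \<in> ranking xs" by auto
  then show "z \<in> ranking (x # xs)"
  proof cases
    case 1
    then obtain j where "j < length xs" "y = xs ! j" by (auto simp: in_set_conv_nth)
    then have "z = ((x # xs) ! 0, (x # xs) ! Suc j)" "0 < Suc j" "Suc j < length (x # xs)"
      using 1 by auto
    then show ?thesis unfolding ranking_def by blast
  next
    case 2
    then obtain i j where "z = (xs ! i, xs ! j)" "i < j" "j < length xs"
      unfolding ranking_def by blast
    then have "z = ((x # xs) ! Suc i, (x # xs) ! Suc j)" "Suc i < Suc j"
      "Suc j < length (x # xs)" by auto
    then show ?thesis unfolding ranking_def by blast
  qed
qed

lemma ranking_subset: "ranking xs \<subseteq> set xs \<times> set xs"
  by (auto simp: ranking_def)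

lemma ranking_in_votes_over:
  "distinct xs \<Longrightarrow> ranking xs \<in> votes_over (set xs)"
proof (induction xs)
  case Nil
  then show ?case
    by (simp add: ranking_def votes_over_def strict_linear_order_on_def trans_def irrefl_def)
next
  case (Cons x xs)
  then have "x \<notin> set xs" "ranking xs \<in> votes_over (set xs)" by auto
  then show ?case
    using ranking_subset[of xs]
    unfolding ranking_Cons votes_over_def strict_linear_order_on_def trans_def irrefl_def
      total_on_def
    by (simp; blast)
qed

lemma votes_over_ex_ranking:
  assumes "finite C" "v \<in> votes_over C"
  shows "\<exists>xs. distinct xs \<and> set xs = C \<and> ranking xs = v"
  using assms
proof (induction C arbitrary: v rule: finite_psubset_induct)
  case (psubset C)
  have v: "v \<subseteq> C \<times> C" "trans v" "irrefl v" "total_on C v"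
    using psubset.prems by (auto simp: votes_over_def strict_linear_order_on_def)
  show ?case
  proof (cases "C = {}")
    case True
    then show ?thesis using v by (intro exI[of _ "[]"]) (auto simp: ranking_def)
  next
    case False
    have "finite v" using v(1) psubset.hyps finite_subset by blast
    moreover have "acyclic v" using v(2,3) by (simp add: acyclic_irrefl trancl_id)
    ultimately have "wf v" by (rule finite_acyclic_wf)
    then obtain x where x: "x \<in> C" "\<And>y. (y, x) \<in> v \<Longrightarrow> y \<notin> C"
      using False by (metis wfE_min ex_in_conv)
    let ?D = "C - {x}" and ?v = "v \<inter> (C - {x}) \<times> (C - {x})"
    have "?v \<in> votes_over ?D"
      using v unfolding votes_over_def strict_linear_order_on_def trans_def irrefl_def
        total_on_def by (simp; blast)
    then obtain xs where xs: "distinct xs" "set xs = ?D" "ranking xs = ?v"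
      using psubset.IH[of ?D ?v] x(1) by blast
    have "v = {x} \<times> ?D \<union> ?v"
      using v x unfolding irrefl_def total_on_def by blast
    then have "ranking (x # xs) = v" using xs by (simp add: ranking_Cons)
    moreover have "distinct (x # xs)" "set (x # xs) = C" using xs x(1) by auto
    ultimately show ?thesis by blast
  qed
qed

lemma ranking_image_eq_votes_over:
  "finite C \<Longrightarrow> ranking ` {xs. distinct xs \<and> set xs = C} = votes_over C"
  using ranking_in_votes_over votes_over_ex_ranking by fastforce

datatype letter = Bit bool | Comma | Semicolon | Bar | Mark

text \<open>Binary digits, least significant first; \<open>0\<close> has no digits.\<close>

fun binary :: "nat \<Rightarrow> bool list" where
  "binary n = (if n = 0 then [] else odd n # binary (n div 2))"

declare binary.simps [simp del]

definition enc_nat :: "nat \<Rightarrow> letter list" where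
  "enc_nat n = map Bit (binary n) @ [Comma]"

definition enc_cands :: "nat list \<Rightarrow> letter list" where
  "enc_cands xs = concat (map enc_nat xs) @ [Semicolon]"

definition enc_votes :: "nat list list \<Rightarrow> letter list" where
  "enc_votes vs = concat (map enc_cands vs) @ [Bar]"

text \<open>The manipulators are listed explicitly, one mark each, so their number counts in unary
  towards the length of the input; the bound \<open>k\<close> is written in binary.\<close>

definition enc_CM :: "nat list \<Rightarrow> nat \<Rightarrow> nat list list \<Rightarrow> nat \<Rightarrow> letter list" where
  "enc_CM cs p vs m = enc_cands cs @ enc_nat p @ enc_votes vs @ replicate m Mark"

definition enc_ECAV ::
  "nat list \<Rightarrow> nat \<Rightarrow> nat list list \<Rightarrow> nat list list \<Rightarrow> nat \<Rightarrow> letter list" where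
  "enc_ECAV cs p vs us k =
     enc_cands cs @ enc_nat p @ enc_votes vs @ enc_votes us @ enc_nat k"

definition valid_rankings :: "nat list \<Rightarrow> nat list list \<Rightarrow> bool" where
  "valid_rankings cs vs \<longleftrightarrow> (\<forall>v \<in> set vs. distinct v \<and> set v = set cs)"

abbreviation profile :: "nat list list \<Rightarrow> nat rel multiset" where
  "profile vs \<equiv> mset (map ranking vs)"

definition Conformant_Manipulation ::
  "(nat set \<Rightarrow> nat rel multiset \<Rightarrow> nat set) \<Rightarrow> letter list set" where
  "Conformant_Manipulation E =
     {enc_CM cs p vs m | cs p vs m.
        distinct cs \<and> p \<in> set cs \<and> valid_rankings cs vs \<and>
        conformant_manipulation E (set cs) (profile vs) m p}"

definition Exact_Control_Adding_Voters ::
  "(nat set \<Rightarrow> nat rel multiset \<Rightarrow> nat set) \<Rightarrow> letter list set" where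
  "Exact_Control_Adding_Voters E =
     {enc_ECAV cs p vs us k | cs p vs us k.
        distinct cs \<and> p \<in> set cs \<and> valid_rankings cs vs \<and> valid_rankings cs us \<and>
        exact_control_adding_voters E (set cs) (profile vs) (profile us) k p}"

end

theory Submission
  imports Defs
begin

text \<open>The instance \<open>(C, V, W, p)\<close> is sent to \<open>(C, V, U, k, p)\<close>, where \<open>k\<close> is the number of
  manipulators and \<open>U\<close> consists of \<open>k\<close> copies of \<open>V\<close>: a choice of \<open>k\<close> voters from \<open>U\<close> is then
  the same as a free choice of \<open>k\<close> votes occurring in \<open>V\<close>.

  On words, \<open>u Bar Mark\<^sup>k\<close> becomes \<open>u Bar c\<^sup>k Bar bin(k) Comma\<close>, where \<open>c\<close> is the part of \<open>u\<close>
  that lists the votes. The machine need not verify that its input encodes an instance: as \<open>u\<close> is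
  copied verbatim, ill-formed input yields ill-formed output. If the input does not even have this
  shape, the machine stops early, and then the output has fewer than two bars.\<close>

section \<open>The reduction on elections\<close>

text \<open>A vote that occurs in \<open>V\<close> at all occurs at least \<open>m\<close> times in
  \<open>repeat_mset m V\<close>, so \<open>m\<close> choices never exhaust the supply. Conversely,
  listing a subcollection of size \<open>m\<close> hands one vote to each manipulator.\<close>

lemma conformant_manipulation_iff_exact_control:
  "conformant_manipulation E C V m p \<longleftrightarrow> exact_control_adding_voters E C V (repeat_mset m V) m p"
proof
  assume "conformant_manipulation E C V m p"
  then obtain w where w: "\<forall>i<m. w i \<in># V" "p \<in> E C (V + image_mset w (mset [0..<m]))"
    unfolding conformant_manipulation_def by blast
  let ?W = "image_mset w (mset [0..<m])"
  have "?W \<subseteq># repeat_mset m V"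
  proof (rule mset_subset_eqI)
    fix v
    show "count ?W v \<le> count (repeat_mset m V) v"
    proof (cases "v \<in># V")
      case True
      have "count ?W v \<le> size ?W" by (rule count_le_size)
      also have "\<dots> \<le> m * count V v" using True by simp
      finally show ?thesis by simp
    next
      case False
      then have "v \<notin># ?W" using w(1) by auto
      then have "count ?W v = 0" by (simp only: not_in_iff)
      then show ?thesis by simp
    qed
  qed
  moreover have "size ?W = m" by simp
  ultimately show "exact_control_adding_voters E C V (repeat_mset m V) m p"
    unfolding exact_control_adding_voters_def using w(2) by blast
next
  assume "exact_control_adding_voters E C V (repeat_mset m V) m p"
  then obtain U where U: "U \<subseteq># repeat_mset m V" "size U = m" "p \<in> E C (V + U)"
    unfolding exact_control_adding_voters_def by blast
  obtain vs where vs: "mset vs = U" using ex_mset by blast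
  then have len: "length vs = m" using U(2) by auto
  have "image_mset ((!) vs) (mset [0..<m]) = U"
    using vs len by (metis map_nth mset_map)
  moreover have "vs ! i \<in># V" if "i < m" for i
  proof -
    have "vs ! i \<in># U" using that len vs by auto
    then have "vs ! i \<in># repeat_mset m V" using U(1) mset_subset_eqD by metis
    then show ?thesis by (simp flip: count_greater_zero_iff)
  qed
  ultimately show "conformant_manipulation E C V m p"
    unfolding conformant_manipulation_def using U(3) by auto
qed

lemma mset_concat_replicate: "mset (concat (replicate m xs)) = repeat_mset m (mset xs)"
  by (induction m) auto

section \<open>Unique readability of the encodings\<close>

text \<open>Both words are cut at their first \<open>z\<close>. All decoding at delimiters rests on
  this.\<close>

lemma append_Cons_eq_first:
  "z \<notin> set xs \<Longrightarrow> z \<notin> set ys \<Longrightarrow> xs @ z # xs' = ys @ z # ys' \<longleftrightarrow> xs = ys \<and> xs' = ys'"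
proof (induction xs arbitrary: ys)
  case Nil
  then show ?case by (cases ys) auto
next
  case (Cons x xs)
  then show ?case by (cases ys) auto
qed

text \<open>Code words are peeled off from the front; as none of them is empty, both lists run out
  together.\<close>

lemma concat_map_prefix_free:
  assumes prefix_free: "\<And>x y r r'. f x @ r = f y @ r' \<Longrightarrow> x = y \<and> r = r'"
    and "\<And>x. f x \<noteq> []"
  shows "concat (map f xs) = concat (map f ys) \<Longrightarrow> xs = ys"
proof (induction xs arbitrary: ys)
  case Nil
  then show ?case using assms(2) by (cases ys) auto
next
  case (Cons x xs)
  then obtain y ys' where ys: "ys = y # ys'" using assms(2) by (cases ys) auto
  then have "f x @ concat (map f xs) = f y @ concat (map f ys')" using Cons.prems by simp
  then show ?case using prefix_free Cons.IH ys by blast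
qed

lemma binary_0 [simp]: "binary 0 = []"
  by (simp add: binary.simps)

lemma binary_pos: "n > 0 \<Longrightarrow> binary n = odd n # binary (n div 2)"
  by (subst binary.simps) simp

lemma inj_binary: "binary m = binary n \<Longrightarrow> m = n"
proof (induction m arbitrary: n rule: less_induct)
  case (less m)
  show ?case
  proof (cases "m = 0 \<or> n = 0")
    case True
    then show ?thesis using less.prems binary_pos by (metis binary_0 list.distinct(1) neq0_conv)
  next
    case False
    then have "odd m = odd n" "binary (m div 2) = binary (n div 2)"
      using less.prems by (simp_all add: binary_pos)
    moreover have "m div 2 = n div 2" using less.IH calculation(2) False by simp
    ultimately show ?thesis by (metis dvd_mult_div_cancel odd_two_times_div_two_succ)
  qed
qed

text \<open>A crude bound is enough for the running time: the counter of the machine counts marks,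
  which the input lists one by one.\<close>

lemma length_binary: "length (binary n) \<le> n"
proof (induction n rule: less_induct)
  case (less n)
  show ?case
  proof (cases "n = 0")
    case False
    then have "length (binary (n div 2)) \<le> n div 2" using less by simp
    then show ?thesis using False by (simp add: binary_pos)
  qed simp
qed

lemma enc_nat_prefix_free: "enc_nat m @ r = enc_nat n @ r' \<Longrightarrow> m = n \<and> r = r'"
proof -
  assume "enc_nat m @ r = enc_nat n @ r'"
  then have eq: "map Bit (binary m) @ Comma # r = map Bit (binary n) @ Comma # r'"
    by (simp add: enc_nat_def)
  have "map Bit (binary m) = map Bit (binary n) \<and> r = r'"
    using eq by (subst (asm) append_Cons_eq_first) auto
  moreover have "inj Bit" by (simp add: inj_def)
  ultimately show ?thesis using inj_binary by (simp add: inj_map_eq_map)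
qed

lemma set_enc_nat: "set (enc_nat n) \<subseteq> insert Comma (range Bit)"
  by (auto simp: enc_nat_def)

lemma Semicolon_notin_enc_nats: "Semicolon \<notin> set (concat (map enc_nat xs))"
  using set_enc_nat by fastforce

text \<open>The first \<open>Semicolon\<close> ends the list, and inside it the numbers are written
  in a prefix-free code without empty words.\<close>

lemma enc_cands_prefix_free: "enc_cands xs @ r = enc_cands ys @ r' \<Longrightarrow> xs = ys \<and> r = r'"
proof -
  assume "enc_cands xs @ r = enc_cands ys @ r'"
  then have "concat (map enc_nat xs) @ Semicolon # r = concat (map enc_nat ys) @ Semicolon # r'"
    by (simp add: enc_cands_def)
  then have eq: "concat (map enc_nat xs) = concat (map enc_nat ys)" "r = r'"
    using append_Cons_eq_first[OF Semicolon_notin_enc_nats Semicolon_notin_enc_nats] by blast+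
  have "xs = ys"
    by (rule concat_map_prefix_free[OF enc_nat_prefix_free _ eq(1)]) (simp_all add: enc_nat_def)
  then show ?thesis using eq(2) by blast
qed

lemma enc_cands_concat_inj:
  assumes "concat (map enc_cands vs) = concat (map enc_cands us)"
  shows "vs = us"
  by (rule concat_map_prefix_free[OF enc_cands_prefix_free _ assms]) (simp_all add: enc_cands_def)

lemma set_enc_cands: "set (enc_cands xs) \<subseteq> insert Semicolon (insert Comma (range Bit))"
  using set_enc_nat by (fastforce simp: enc_cands_def)

lemma Bar_notin_enc:
  "Bar \<notin> set (enc_nat n)" "Bar \<notin> set (enc_cands xs)" "Bar \<notin> set (concat (map enc_cands vs))"
  using set_enc_nat set_enc_cands by fastforce+

section \<open>Shapes of encoded instances and correctness of the map on words\<close>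

text \<open>The three delimiters at which an instance is decoded are exposed as heads of lists,
  ready for \<open>append_Cons_eq_first\<close>.\<close>

lemma enc_CM_shape:
  "enc_CM cs p vs m =
     (concat (map enc_nat cs) @ Semicolon # map Bit (binary p) @ Comma # concat (map enc_cands vs))
     @ Bar # replicate m Mark"
  by (simp add: enc_CM_def enc_cands_def enc_nat_def enc_votes_def)

lemma enc_ECAV_shape:
  "enc_ECAV cs p vs us k =
     (concat (map enc_nat cs) @ Semicolon # map Bit (binary p) @ Comma # concat (map enc_cands vs))
     @ Bar # concat (map enc_cands us) @ Bar # enc_nat k"
  by (simp add: enc_ECAV_def enc_cands_def enc_nat_def enc_votes_def)

lemma Bar_notin_header:
  "Bar \<notin> set (concat (map enc_nat cs) @ Semicolon # map Bit (binary p) @ Comma #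
     concat (map enc_cands vs))"
  using Bar_notin_enc by auto

text \<open>Each \<open>enc_votes\<close> block ends with a \<open>Bar\<close>. This rejects the
  outputs of all runs that stop early.\<close>

lemma few_bars_notin_ECAV:
  assumes "count_list y Bar < 2"
  shows "y \<notin> Exact_Control_Adding_Voters E"
proof
  assume "y \<in> Exact_Control_Adding_Voters E"
  then obtain cs p vs us k where "y = enc_ECAV cs p vs us k"
    unfolding Exact_Control_Adding_Voters_def by blast
  then have "y = enc_cands cs @ enc_nat p @ concat (map enc_cands vs) @ [Bar] @
      concat (map enc_cands us) @ [Bar] @ enc_nat k"
    by (simp add: enc_ECAV_def enc_votes_def)
  then have "count_list y Bar \<ge> 2" by (simp only: count_list_append) simp
  then show False using assms by simp
qed

text \<open>Used contrapositively: on a word of any other shape the machine may stop early.\<close>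

lemma Conformant_Manipulation_shape:
  assumes "x \<in> Conformant_Manipulation E"
  obtains a b c m where "x = (a @ Semicolon # b @ Comma # c) @ Bar # replicate m Mark"
    "Semicolon \<notin> set a" "Comma \<notin> set b" "Bar \<notin> set (a @ Semicolon # b @ Comma # c)"
proof -
  from assms obtain cs p vs m where "x = enc_CM cs p vs m"
    unfolding Conformant_Manipulation_def by blast
  then show thesis
    using that[OF _ Semicolon_notin_enc_nats _ Bar_notin_header] unfolding enc_CM_shape by fastforce
qed

text \<open>\<open>a\<close>, \<open>b\<close> and \<open>c\<close> need not encode anything. If
  either word lies in its language, unique readability forces them to encode candidates,
  \<open>p\<close> and votes; both words then describe instances with the same data, and the
  equivalence on elections applies.\<close>

lemma reduction_correct:
  assumes "Semicolon \<notin> set a" "Comma \<notin> set b" "Bar \<notin> set (a @ Semicolon # b @ Comma # c)"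
  shows "(a @ Semicolon # b @ Comma # c) @ Bar # replicate m Mark \<in> Conformant_Manipulation E \<longleftrightarrow>
    (a @ Semicolon # b @ Comma # c) @ Bar # concat (replicate m c) @ Bar # enc_nat m
      \<in> Exact_Control_Adding_Voters E"
    (is "?x \<in> _ \<longleftrightarrow> ?y \<in> _")
proof -
  \<comment> \<open>Cut at the first \<open>Bar\<close>, then at the first \<open>Semicolon\<close>,
    then at the first \<open>Comma\<close> after it. The tail \<open>r\<close> stays free so that
    this serves both languages.\<close>
  have header: "a = concat (map enc_nat cs) \<and> b = map Bit (binary p) \<and> c = concat (map enc_cands vs) \<and>
      r = r'"
    if "(a @ Semicolon # b @ Comma # c) @ Bar # r =
      (concat (map enc_nat cs) @ Semicolon # map Bit (binary p) @ Comma # concat (map enc_cands vs))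
      @ Bar # r'" for cs p vs r r'
  proof -
    have "a @ Semicolon # b @ Comma # c =
        concat (map enc_nat cs) @ Semicolon # map Bit (binary p) @ Comma # concat (map enc_cands vs)"
      and r: "r = r'"
      using that append_Cons_eq_first[OF assms(3) Bar_notin_header] by blast+
    then have a: "a = concat (map enc_nat cs)"
      and "b @ Comma # c = map Bit (binary p) @ Comma # concat (map enc_cands vs)"
      using append_Cons_eq_first[OF assms(1) Semicolon_notin_enc_nats] by blast+
    then have "b = map Bit (binary p) \<and> c = concat (map enc_cands vs)"
      using append_Cons_eq_first[of Comma b "map Bit (binary p)"] assms(2) by auto
    then show ?thesis using a r by blast
  qed
  \<comment> \<open>The word \<open>c\<close> excludes the closing \<open>Bar\<close>, so repeating
    it amounts to repeating the list of votes.\<close>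
  have votes: "concat (replicate m (concat (map enc_cands vs))) =
      concat (map enc_cands (concat (replicate m vs)))" for vs
    by (induction m) auto
  have profile: "profile (concat (replicate m vs)) = repeat_mset m (profile vs)" for vs
    by (metis map_concat map_replicate mset_concat_replicate)
  have valid: "valid_rankings cs (concat (replicate m vs))" if "valid_rankings cs vs" for cs vs
    using that by (auto simp: valid_rankings_def)
  show ?thesis
  proof
    assume "?x \<in> Conformant_Manipulation E"
    then obtain cs p vs m' where x: "?x = enc_CM cs p vs m'"
      and cs: "distinct cs" "p \<in> set cs" "valid_rankings cs vs"
      and cm: "conformant_manipulation E (set cs) (profile vs) m' p"
      unfolding Conformant_Manipulation_def by blast
    have h: "a = concat (map enc_nat cs)" "b = map Bit (binary p)" "c = concat (map enc_cands vs)"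
      "replicate m Mark = replicate m' Mark"
      using header[OF x[unfolded enc_CM_shape]] by blast+
    then have m: "m' = m" by simp
    have "?y = enc_ECAV cs p vs (concat (replicate m vs)) m"
      unfolding enc_ECAV_shape h votes by simp
    moreover have "exact_control_adding_voters E (set cs) (profile vs)
        (profile (concat (replicate m vs))) m p"
      using cm unfolding m conformant_manipulation_iff_exact_control profile .
    ultimately show "?y \<in> Exact_Control_Adding_Voters E"
      unfolding Exact_Control_Adding_Voters_def using cs valid by blast
  next
    assume "?y \<in> Exact_Control_Adding_Voters E"
    then obtain cs p vs us k where y: "?y = enc_ECAV cs p vs us k"
      and cs: "distinct cs" "p \<in> set cs" "valid_rankings cs vs"
      and ec: "exact_control_adding_voters E (set cs) (profile vs) (profile us) k p"
      unfolding Exact_Control_Adding_Voters_def by blast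
    have h: "a = concat (map enc_nat cs)" "b = map Bit (binary p)" "c = concat (map enc_cands vs)"
      "concat (replicate m c) @ Bar # enc_nat m = concat (map enc_cands us) @ Bar # enc_nat k"
      using header[OF y[unfolded enc_ECAV_shape]] by blast+
    have "Bar \<notin> set (concat (replicate m c))" using assms(3) by auto
    then have eq: "concat (replicate m c) = concat (map enc_cands us)" "enc_nat m = enc_nat k"
      using h(4) append_Cons_eq_first[OF _ Bar_notin_enc(3)] by blast+
    \<comment> \<open>The output word determines both \<open>us\<close> and \<open>k\<close>, so it
      cannot be a yes-instance through another reading.\<close>
    have us: "us = concat (replicate m vs)"
      using eq(1) enc_cands_concat_inj unfolding h(3) votes by blast
    have k: "k = m" using enc_nat_prefix_free[of m "[]" k "[]"] eq(2) by simp
    have "?x = enc_CM cs p vs m" unfolding enc_CM_shape h ..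
    moreover have "conformant_manipulation E (set cs) (profile vs) m p"
      using ec unfolding us k conformant_manipulation_iff_exact_control profile .
    ultimately show "?x \<in> Conformant_Manipulation E"
      unfolding Conformant_Manipulation_def using cs by blast
  qed
qed

section \<open>Tapes and computations\<close>

text \<open>Zipper form: the head is on the first letter of \<open>r\<close>, or on the blank just
  after the word if \<open>r\<close> is empty.\<close>

definition tape_at :: "'a list \<Rightarrow> 'a list \<Rightarrow> 'a tape" where
  "tape_at l r = (word_content (l @ r), int (length l))"

text \<open>The head is on the last letter of \<open>l\<close>, or on the blank to the left of the word if \<open>l\<close> is
  empty.\<close>

definition tape_before :: "'a list \<Rightarrow> 'a list \<Rightarrow> 'a tape" where
  "tape_before l r = (word_content (l @ r), int (length l) - 1)"

lemma word_content_update: "(word_content (l @ a # r))(int (length l) := Letter b) = word_content (l @ b # r)"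
  by (auto simp: word_content_def fun_eq_iff nth_append nth_Cons')

lemma word_content_snoc: "(word_content l)(int (length l) := Letter b) = word_content (l @ [b])"
  by (auto simp: word_content_def fun_eq_iff nth_append)

lemma word_content_end: "word_content l (int (length l)) = Blank"
  by (simp add: word_content_def)

lemma word_content_nth: "word_content (l @ a # r) (int (length l)) = Letter a"
  by (simp add: word_content_def)

lemma word_content_minus_1: "word_content l (- 1) = Blank"
  by (simp add: word_content_def)

lemma fun_upd_idem_Blank: "t i = Blank \<Longrightarrow> t(i := Blank) = t"
  by auto

lemma scan_tape [simp]:
  "scan (tape_at l (a # r)) = Letter a"
  "scan (tape_at l []) = Blank"
  "scan (tape_before [] r) = Blank"
  by (simp_all add: tape_at_def tape_before_def word_content_end word_content_nth word_content_minus_1)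

text \<open>The \<open>scan\<close> rule for \<open>tape_before\<close> covers an empty left part
  only; this covers the other case during leftward runs.\<close>

lemma tape_before_snoc [simp]: "tape_before (l @ [a]) r = tape_at l (a # r)"
  by (simp add: tape_at_def tape_before_def)

lemma act_stay [simp]: "act (scan t, Stay) t = t"
  by (cases t) simp

text \<open>Once \<open>scan\<close> has been evaluated, \<open>act_stay\<close> no longer matches;
  these are its instances with the scanned cell explicit.\<close>

lemma act_stay_tape [simp]:
  "act (Letter a, Stay) (tape_at l (a # r)) = tape_at l (a # r)"
  "act (Blank, Stay) (tape_at l []) = tape_at l []"
  "act (Blank, Stay) (tape_before [] r) = tape_before [] r"
  \<comment> \<open>With \<open>act_stay\<close> in the simpset these facts would collapse to
    \<open>True\<close>.\<close>
  using act_stay[of "tape_at l (a # r)"] act_stay[of "tape_at l []"] act_stay[of "tape_before [] r"]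
  by (simp_all del: act_stay)

lemma act_tape [simp]:
  "act (Letter b, MoveRight) (tape_at l (a # r)) = tape_at (l @ [b]) r"
  "act (Letter b, MoveRight) (tape_at l []) = tape_at (l @ [b]) []"
  "act (Letter b, MoveLeft) (tape_at l (a # r)) = tape_before l (b # r)"
  "act (Letter b, MoveLeft) (tape_at l []) = tape_before l [b]"
  "act (Blank, MoveLeft) (tape_at l []) = tape_before l []"
  "act (Blank, MoveRight) (tape_before [] r) = tape_at [] r"
  by (simp_all add: tape_at_def tape_before_def word_content_update word_content_snoc
      fun_upd_idem_Blank word_content_end word_content_minus_1)

text \<open>An upper bound rather than an exact count, so that bounds can be added and rounded
  up.\<close>

definition reaches :: "'a tm \<Rightarrow> nat \<Rightarrow> 'a config \<Rightarrow> 'a config \<Rightarrow> bool" where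
  "reaches M n c c' \<longleftrightarrow> (\<exists>t \<le> n. (step M ^^ t) c = c')"

lemma reaches_refl: "reaches M n c c"
  unfolding reaches_def by (rule exI[of _ 0]) simp

lemma reaches_trans: "reaches M m c c' \<Longrightarrow> reaches M n c' c'' \<Longrightarrow> reaches M (m + n) c c''"
  unfolding reaches_def
proof (elim exE conjE)
  fix s t assume "s \<le> m" "t \<le> n" "(step M ^^ s) c = c'" "(step M ^^ t) c' = c''"
  then have "t + s \<le> m + n" "(step M ^^ (t + s)) c = c''"
    by (simp_all add: funpow_add)
  then show "\<exists>t \<le> m + n. (step M ^^ t) c = c''" by blast
qed

lemma reaches_mono: "reaches M m c c' \<Longrightarrow> m \<le> n \<Longrightarrow> reaches M n c c'"
  unfolding reaches_def using order_trans by blast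

lemma reaches_one: "step M c = c' \<Longrightarrow> reaches M 1 c c'"
  unfolding reaches_def by (rule exI[of _ 1]) simp

lemma reaches_Suc: "step M c = c' \<Longrightarrow> reaches M n c' c'' \<Longrightarrow> reaches M (Suc n) c c''"
  using reaches_trans[OF reaches_one] by fastforce

section \<open>The machine\<close>

abbreviation (input) "copy_cands \<equiv> 0 :: nat"
abbreviation (input) "copy_pref \<equiv> 1 :: nat"
abbreviation (input) "copy_votes \<equiv> 2 :: nat"
abbreviation (input) "read_mark \<equiv> 3 :: nat"
abbreviation (input) "rewind \<equiv> 4 :: nat"
abbreviation (input) "paste_votes \<equiv> 5 :: nat"
abbreviation (input) "incr_counter \<equiv> 6 :: nat"
abbreviation (input) "rewind_counter \<equiv> 7 :: nat"
abbreviation (input) "paste_counter \<equiv> 8 :: nat"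
abbreviation (input) "halted \<equiv> 9 :: nat"

text \<open>The four tapes hold the input, the votes, a binary counter of the marks read so far, and the
  output.\<close>

fun reduction_delta ::
  "nat \<Rightarrow> letter cell list \<Rightarrow> nat \<times> (letter cell \<times> move) list" where
  "reduction_delta q [a, b, c, d] =
    (if q = copy_cands then
       if a = Blank \<or> a = Letter Bar then (halted, [(a, Stay), (b, Stay), (c, Stay), (d, Stay)])
       else (if a = Letter Semicolon then copy_pref else copy_cands,
             [(a, MoveRight), (b, Stay), (c, Stay), (a, MoveRight)])
     else if q = copy_pref then
       if a = Blank \<or> a = Letter Bar then (halted, [(a, Stay), (b, Stay), (c, Stay), (d, Stay)])
       else (if a = Letter Comma then copy_votes else copy_pref,
             [(a, MoveRight), (b, Stay), (c, Stay), (a, MoveRight)])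
     else if q = copy_votes then
       if a = Blank then (halted, [(a, Stay), (b, Stay), (c, Stay), (d, Stay)])
       else if a = Letter Bar then
         (read_mark, [(a, MoveRight), (b, Stay), (c, Stay), (a, MoveRight)])
       else (copy_votes, [(a, MoveRight), (a, MoveRight), (c, Stay), (a, MoveRight)])
     else if q = read_mark then
       if a = Letter Mark then (rewind, [(a, MoveRight), (b, MoveLeft), (c, Stay), (d, Stay)])
       else if a = Blank then
         (paste_counter, [(a, Stay), (b, Stay), (c, Stay), (Letter Bar, MoveRight)])
       else (halted, [(a, Stay), (b, Stay), (c, Stay), (d, Stay)])
     else if q = rewind then
       if b = Blank then (paste_votes, [(a, Stay), (b, MoveRight), (c, Stay), (d, Stay)])
       else (rewind, [(a, Stay), (b, MoveLeft), (c, Stay), (d, Stay)])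
     else if q = paste_votes then
       if b = Blank then (incr_counter, [(a, Stay), (b, Stay), (c, Stay), (d, Stay)])
       else (paste_votes, [(a, Stay), (b, MoveRight), (c, Stay), (b, MoveRight)])
     else if q = incr_counter then
       if c = Letter (Bit True) then
         (incr_counter, [(a, Stay), (b, Stay), (Letter (Bit False), MoveRight), (d, Stay)])
       else (rewind_counter, [(a, Stay), (b, Stay), (Letter (Bit True), MoveLeft), (d, Stay)])
     else if q = rewind_counter then
       if c = Blank then (read_mark, [(a, Stay), (b, Stay), (c, MoveRight), (d, Stay)])
       else (rewind_counter, [(a, Stay), (b, Stay), (c, MoveLeft), (d, Stay)])
     else
       if c = Blank then (halted, [(a, Stay), (b, Stay), (c, Stay), (Letter Comma, MoveRight)])
       else (paste_counter, [(a, Stay), (b, Stay), (c, MoveRight), (c, MoveRight)]))"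
| "reduction_delta q _ = (halted, [])"

definition reduction_tm :: "letter tm" where
  "reduction_tm = \<lparr>tm_tapes = 4, tm_states = {..halted}, tm_start = copy_cands, tm_halt = halted,
     tm_alphabet = insert Blank (range Letter), tm_delta = reduction_delta\<rparr>"

lemma finite_letters: "finite (UNIV :: letter set)"
proof -
  have "UNIV = {Bit True, Bit False, Comma, Semicolon, Bar, Mark}"
  proof (intro set_eqI iffI)
    fix l :: letter
    show "l \<in> {Bit True, Bit False, Comma, Semicolon, Bar, Mark}" by (cases l) auto
  qed simp
  then show ?thesis by (metis finite.emptyI finite.insertI)
qed

lemma wf_reduction_tm: "wf_tm reduction_tm"
proof -
  \<comment> \<open>Every written cell is a scanned one or a fixed letter, so any \<open>A\<close>
    containing all letters is closed under writing.\<close>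
  have "fst (reduction_delta q cs) \<in> {..halted} \<and> length (snd (reduction_delta q cs)) = 4 \<and>
      fst ` set (snd (reduction_delta q cs)) \<subseteq> A"
    if "cs \<in> lists A" "length cs = 4" "Blank \<in> A" "\<And>l. Letter l \<in> A" for q cs A
  proof -
    obtain a b c d where "cs = [a, b, c, d]"
      using \<open>length cs = 4\<close> by (auto simp: numeral_eq_Suc length_Suc_conv)
    then show ?thesis using that by simp
  qed
  then show ?thesis by (simp add: wf_tm_def reduction_tm_def finite_letters)
qed

text \<open>Replaces \<open>step.simps\<close> in the simpset: \<open>reduction_tm\<close> stays
  folded and only explicit four-tape configurations are evaluated.\<close>

lemma step_reduction_tm [simp]:
  "step reduction_tm (q, [t0, t1, t2, t3]) =
     (if q = halted then (q, [t0, t1, t2, t3])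
      else case reduction_delta q [scan t0, scan t1, scan t2, scan t3] of
        (q', as) \<Rightarrow> (q', map2 act as [t0, t1, t2, t3]))"
  by (simp add: reduction_tm_def)

declare step.simps [simp del]

lemma init_reduction_tm:
  "init_config reduction_tm x =
     (copy_cands, [tape_at [] x, tape_at [] [], tape_at [] [], tape_at [] []])"
  by (simp add: init_config_def reduction_tm_def tape_at_def numeral_eq_Suc)

lemma reaches_halted_outputs_within:
  assumes "reaches reduction_tm n (init_config reduction_tm x) (halted, [t0, t1, t2, tape_at y []])"
  shows "outputs_within reduction_tm x y n"
proof -
  obtain t where "t \<le> n"
    "(step reduction_tm ^^ t) (init_config reduction_tm x) = (halted, [t0, t1, t2, tape_at y []])"
    using assms unfolding reaches_def by blast
  then show ?thesis
    unfolding outputs_within_def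
    by (intro exI[of _ t]) (simp add: reduction_tm_def tape_at_def)
qed

section \<open>Runs of the single phases\<close>

text \<open>The run pauses where \<open>a\<close> ends. Whether a \<open>Semicolon\<close>, a
  \<open>Bar\<close> or a blank follows is left to \<open>r\<close>, so well-formed and ill-formed
  inputs share this lemma.\<close>

lemma run_copy_cands:
  "Semicolon \<notin> set a \<Longrightarrow> Bar \<notin> set a \<Longrightarrow>
   reaches reduction_tm (length a) (copy_cands, [tape_at l (a @ r), t1, t2, tape_at y []])
     (copy_cands, [tape_at (l @ a) r, t1, t2, tape_at (y @ a) []])"
proof (induction a arbitrary: l y)
  case (Cons z a)
  show ?case
    unfolding list.size(4) add_Suc_right
    by (rule reaches_Suc) (use Cons.IH[of "l @ [z]" "y @ [z]"] Cons.prems in auto)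
qed (simp add: reaches_refl)

lemma run_copy_pref:
  "Comma \<notin> set b \<Longrightarrow> Bar \<notin> set b \<Longrightarrow>
   reaches reduction_tm (length b) (copy_pref, [tape_at l (b @ r), t1, t2, tape_at y []])
     (copy_pref, [tape_at (l @ b) r, t1, t2, tape_at (y @ b) []])"
proof (induction b arbitrary: l y)
  case (Cons z b)
  show ?case
    unfolding list.size(4) add_Suc_right
    by (rule reaches_Suc) (use Cons.IH[of "l @ [z]" "y @ [z]"] Cons.prems in auto)
qed (simp add: reaches_refl)

lemma run_copy_votes:
  "Bar \<notin> set c \<Longrightarrow>
   reaches reduction_tm (length c) (copy_votes, [tape_at l (c @ r), tape_at u [], t2, tape_at y []])
     (copy_votes, [tape_at (l @ c) r, tape_at (u @ c) [], t2, tape_at (y @ c) []])"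
proof (induction c arbitrary: l u y)
  case (Cons z c)
  show ?case
    unfolding list.size(4) add_Suc_right
    by (rule reaches_Suc) (use Cons.IH[of "l @ [z]" "u @ [z]" "y @ [z]"] Cons.prems in auto)
qed (simp add: reaches_refl)

text \<open>Induction from the right end, as the head moves left. The extra step returns from the
  blank left of the word to its first cell.\<close>

lemma run_rewind:
  "reaches reduction_tm (Suc (length l)) (rewind, [t0, tape_before l r, t2, t3])
     (paste_votes, [t0, tape_at [] (l @ r), t2, t3])"
proof (induction l arbitrary: r rule: rev_induct)
  case Nil
  show ?case by (rule reaches_Suc[OF _ reaches_refl]) simp
next
  case (snoc z l)
  show ?case
    unfolding length_append_singleton
    by (rule reaches_Suc) (use snoc[of "z # r"] in auto)
qed

lemma run_paste_votes:
  "reaches reduction_tm (Suc (length c)) (paste_votes, [t0, tape_at l c, t2, tape_at y []])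
     (incr_counter, [t0, tape_at (l @ c) [], t2, tape_at (y @ c) []])"
proof (induction c arbitrary: l y)
  case Nil
  show ?case by (rule reaches_Suc[OF _ reaches_refl]) simp
next
  case (Cons z c)
  show ?case
    unfolding list.size(4) add_Suc_right
    by (rule reaches_Suc) (use Cons.IH[of "l @ [z]" "y @ [z]"] in auto)
qed

lemma run_rewind_counter:
  "reaches reduction_tm (Suc (length l)) (rewind_counter, [t0, t1, tape_before l r, t3])
     (read_mark, [t0, t1, tape_at [] (l @ r), t3])"
proof (induction l arbitrary: r rule: rev_induct)
  case Nil
  show ?case by (rule reaches_Suc[OF _ reaches_refl]) simp
next
  case (snoc z l)
  show ?case
    unfolding length_append_singleton
    by (rule reaches_Suc) (use snoc[of "z # r"] in auto)
qed

text \<open>Binary successor, least significant digit first; the recursion follows the carry just as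
  state \<open>incr_counter\<close> does.\<close>

fun incr :: "bool list \<Rightarrow> bool list" where
  "incr [] = [True]"
| "incr (False # bs) = True # bs"
| "incr (True # bs) = False # incr bs"

lemma binary_Suc: "binary (Suc n) = incr (binary n)"
proof (induction n rule: less_induct)
  case (less n)
  show ?case
  proof (cases "n = 0")
    case False
    show ?thesis
    proof (cases "even n")
      case True
      then show ?thesis using False by (simp add: binary_pos)
    next
      case odd: False
      then have "Suc n div 2 = Suc (n div 2)" by simp
      then show ?thesis using False odd less[of "n div 2"] by (simp add: binary_pos)
    qed
  qed (simp add: binary_pos)
qed

text \<open>\<open>l\<close> is the part of the counter already passed by the carry. Each further
  carry costs one step to the right and one back, hence the factor 2; \<open>length l\<close> pays
  for rewinding over \<open>l\<close>.\<close>

lemma run_incr_counter: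
  "reaches reduction_tm (2 * length bs + length l + 2)
     (incr_counter, [t0, t1, tape_at l (map Bit bs), t3])
     (read_mark, [t0, t1, tape_at [] (l @ map Bit (incr bs)), t3])"
proof (induction bs arbitrary: l rule: incr.induct)
  case 1
  have "reaches reduction_tm (Suc (Suc (length l))) (incr_counter, [t0, t1, tape_at l [], t3])
     (read_mark, [t0, t1, tape_at [] (l @ [Bit True]), t3])"
    by (rule reaches_Suc[OF _ run_rewind_counter]) simp
  then show ?case by (auto elim!: reaches_mono)
next
  case (2 bs)
  have "reaches reduction_tm (Suc (Suc (length l)))
     (incr_counter, [t0, t1, tape_at l (Bit False # map Bit bs), t3])
     (read_mark, [t0, t1, tape_at [] (l @ Bit True # map Bit bs), t3])"
    by (rule reaches_Suc[OF _ run_rewind_counter]) simp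
  then show ?case by (auto elim!: reaches_mono)
next
  case (3 bs)
  have "reaches reduction_tm (Suc (2 * length bs + length (l @ [Bit False]) + 2))
     (incr_counter, [t0, t1, tape_at l (Bit True # map Bit bs), t3])
     (read_mark, [t0, t1, tape_at [] ((l @ [Bit False]) @ map Bit (incr bs)), t3])"
    by (rule reaches_Suc[OF _ 3]) simp
  then show ?case by (auto elim!: reaches_mono)
qed

lemma run_paste_counter:
  "reaches reduction_tm (Suc (length c)) (paste_counter, [t0, t1, tape_at l c, tape_at y []])
     (halted, [t0, t1, tape_at (l @ c) [], tape_at (y @ c @ [Comma]) []])"
proof (induction c arbitrary: l y)
  case Nil
  show ?case by (rule reaches_Suc[OF _ reaches_refl]) simp
next
  case (Cons z c)
  show ?case
    unfolding list.size(4) add_Suc_right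
    by (rule reaches_Suc) (use Cons.IH[of "l @ [z]" "y @ [z]"] in auto)
qed

text \<open>One round of the main loop: rewind the votes tape, paste it, increment the counter. The
  heads on the votes and counter tapes return to their initial positions, so rounds can be
  chained.\<close>

lemma run_one_mark:
  "reaches reduction_tm (2 * length c + 2 * j + 5)
     (read_mark, [tape_at l (Mark # r), tape_at c [], tape_at [] (map Bit (binary j)), tape_at y []])
     (read_mark, [tape_at (l @ [Mark]) r, tape_at c [], tape_at [] (map Bit (binary (Suc j))),
        tape_at (y @ c) []])"
proof -
  \<comment> \<open>The outer \<open>Suc\<close> is the step reading the mark; the \<open>0\<close>
    is the length of the empty prefix \<open>l\<close> in \<open>run_incr_counter\<close>.\<close>
  have "reaches reduction_tm (Suc (Suc (length c) + (Suc (length c) + (2 * length (binary j) + 0 + 2))))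
     (read_mark, [tape_at l (Mark # r), tape_at c [], tape_at [] (map Bit (binary j)), tape_at y []])
     (read_mark, [tape_at (l @ [Mark]) r, tape_at c [], tape_at [] (map Bit (binary (Suc j))),
        tape_at (y @ c) []])"
  proof (rule reaches_Suc)
    show "reaches reduction_tm (Suc (length c) + (Suc (length c) + (2 * length (binary j) + 0 + 2)))
      (rewind, [tape_at (l @ [Mark]) r, tape_before c [], tape_at [] (map Bit (binary j)), tape_at y []])
      (read_mark, [tape_at (l @ [Mark]) r, tape_at c [], tape_at [] (map Bit (binary (Suc j))),
        tape_at (y @ c) []])"
      using reaches_trans[OF run_rewind[of c _ "[]", simplified]
          reaches_trans[OF run_paste_votes[of c _ "[]", simplified] run_incr_counter[of "binary j" "[]"]]]
      by (simp add: binary_Suc)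
  qed simp
  then show ?thesis
    by (rule reaches_mono) (use length_binary[of j] in simp)
qed

text \<open>The counter never exceeds \<open>j + m\<close>, which gives one bound for all rounds and
  a quadratic total.\<close>

lemma run_marks:
  "reaches reduction_tm (m * (2 * length c + 2 * (j + m) + 5))
     (read_mark, [tape_at l (replicate m Mark @ r), tape_at c [], tape_at [] (map Bit (binary j)),
        tape_at y []])
     (read_mark, [tape_at (l @ replicate m Mark) r, tape_at c [],
        tape_at [] (map Bit (binary (j + m))), tape_at (y @ concat (replicate m c)) []])"
proof (induction m arbitrary: j l y)
  case (Suc m)
  have "reaches reduction_tm
      (2 * length c + 2 * j + 5 + m * (2 * length c + 2 * (Suc j + m) + 5))
     (read_mark, [tape_at l (replicate (Suc m) Mark @ r), tape_at c [],
        tape_at [] (map Bit (binary j)), tape_at y []])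
     (read_mark, [tape_at (l @ replicate (Suc m) Mark) r, tape_at c [],
        tape_at [] (map Bit (binary (j + Suc m))), tape_at (y @ concat (replicate (Suc m) c)) []])"
    using reaches_trans[OF run_one_mark[of c j l "replicate m Mark @ r" y]
        Suc.IH[of "Suc j" "l @ [Mark]" "y @ c"]]
    by simp
  then show ?case
    by (rule reaches_mono) (simp add: algebra_simps)
qed (simp add: reaches_refl)

section \<open>The phases composed on a whole input\<close>

lemma run_copy_header:
  assumes "Semicolon \<notin> set a" "Bar \<notin> set a"
  shows "reaches reduction_tm (length a + 1) (init_config reduction_tm (a @ Semicolon # r))
     (copy_pref, [tape_at (a @ [Semicolon]) r, tape_at [] [], tape_at [] [],
        tape_at (a @ [Semicolon]) []])"
  unfolding init_reduction_tm
  by (rule reaches_trans[OF run_copy_cands[OF assms, of "[]" _ _ _ "[]", simplified] reaches_one])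
    simp

lemma run_copy_header_pref:
  assumes "Semicolon \<notin> set a" "Comma \<notin> set b" "Bar \<notin> set a" "Bar \<notin> set b"
  shows "reaches reduction_tm (length a + length b + 2)
     (init_config reduction_tm (a @ Semicolon # b @ Comma # r))
     (copy_votes, [tape_at (a @ Semicolon # b @ [Comma]) r, tape_at [] [], tape_at [] [],
        tape_at (a @ Semicolon # b @ [Comma]) []])"
proof -
  have "reaches reduction_tm (length a + 1 + (length b + 1))
     (init_config reduction_tm (a @ Semicolon # b @ Comma # r))
     (copy_votes, [tape_at (a @ Semicolon # b @ [Comma]) r, tape_at [] [], tape_at [] [],
        tape_at (a @ Semicolon # b @ [Comma]) []])"
    by (rule reaches_trans[OF run_copy_header reaches_trans[OF run_copy_pref reaches_one]])
      (use assms in simp_all)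
  then show ?thesis by (simp add: algebra_simps)
qed

lemma run_copy_all:
  assumes "Semicolon \<notin> set a" "Comma \<notin> set b" "Bar \<notin> set (a @ Semicolon # b @ Comma # c)"
  shows "reaches reduction_tm (length (a @ Semicolon # b @ Comma # c))
     (init_config reduction_tm ((a @ Semicolon # b @ Comma # c) @ r))
     (copy_votes, [tape_at (a @ Semicolon # b @ Comma # c) r, tape_at c [], tape_at [] [],
        tape_at (a @ Semicolon # b @ Comma # c) []])"
proof -
  have "reaches reduction_tm (length a + length b + 2 + length c)
     (init_config reduction_tm (a @ Semicolon # b @ Comma # c @ r))
     (copy_votes, [tape_at ((a @ Semicolon # b @ [Comma]) @ c) r, tape_at ([] @ c) [], tape_at [] [],
        tape_at ((a @ Semicolon # b @ [Comma]) @ c) []])"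
    by (rule reaches_trans[OF run_copy_header_pref run_copy_votes]) (use assms in auto)
  then show ?thesis by (simp add: algebra_simps)
qed

lemma run_all_marks:
  assumes "Semicolon \<notin> set a" "Comma \<notin> set b" "Bar \<notin> set (a @ Semicolon # b @ Comma # c)"
  defines "u \<equiv> a @ Semicolon # b @ Comma # c"
  shows "reaches reduction_tm (length u + 1 + m * (2 * length c + 2 * m + 5))
     (init_config reduction_tm (u @ Bar # replicate m Mark @ r))
     (read_mark, [tape_at (u @ Bar # replicate m Mark) r, tape_at c [],
        tape_at [] (map Bit (binary m)), tape_at (u @ Bar # concat (replicate m c)) []])"
proof -
  \<comment> \<open>The blank counter tape represents \<open>binary 0\<close>, so the loop starts
    with \<open>j = 0\<close>. The added 1 is the step copying \<open>Bar\<close>.\<close>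
  have "reaches reduction_tm (length u + (1 + m * (2 * length c + 2 * (0 + m) + 5)))
     (init_config reduction_tm (u @ Bar # replicate m Mark @ r))
     (read_mark, [tape_at ((u @ [Bar]) @ replicate m Mark) r, tape_at c [],
        tape_at [] (map Bit (binary (0 + m))), tape_at ((u @ [Bar]) @ concat (replicate m c)) []])"
    unfolding u_def
    by (rule reaches_trans[OF run_copy_all[OF assms(1-3)] reaches_trans[OF reaches_one run_marks]])
      simp
  then show ?thesis by (simp add: algebra_simps)
qed

section \<open>Case analysis over all input words\<close>

lemma split_at_first:
  obtains "z \<notin> set xs" | ys zs where "xs = ys @ z # zs" "z \<notin> set ys"
  using split_list_first by metis

text \<open>With \<open>n = length x\<close>, the marks cost at most \<open>n * (2 * n + 5)\<close>
  steps and everything else at most \<open>n + 2\<close>, which stays below the polynomial.\<close>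

lemma reduction_run:
  "\<exists>y. outputs_within reduction_tm x y (poly [:2, 7, 2:] (length x)) \<and>
     (x \<in> Conformant_Manipulation E \<longleftrightarrow> y \<in> Exact_Control_Adding_Voters E)"
    (is "\<exists>y. ?ok y")
proof -
  let ?b = "poly [:2, 7, 2:] (length x)"
  let ?init = "init_config reduction_tm x"
  \<comment> \<open>Common to all early stops: input and output both lie outside their
    languages.\<close>
  have halt_early: "?ok y"
    if "reaches reduction_tm n ?init (halted, [t0, t1, t2, tape_at y []])" "n \<le> ?b"
      "count_list y Bar < 2" "x \<notin> Conformant_Manipulation E" for n t0 t1 t2 y
    using that few_bars_notin_ECAV reaches_halted_outputs_within[OF reaches_mono] by blast
  define u where "u = takeWhile (\<lambda>l. l \<noteq> Bar) x"
  define v where "v = dropWhile (\<lambda>l. l \<noteq> Bar) x"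
  have x: "x = u @ v" by (simp add: u_def v_def)
  have early: "length u + 1 \<le> ?b" by (simp add: x algebra_simps)
  have Bar_u: "Bar \<notin> set u" by (auto simp: u_def dest: set_takeWhileD)
  then have count_u: "count_list u Bar = 0" by (simp add: count_list_0_iff)
  have v: "v = [] \<or> (\<exists>r. v = Bar # r)"
    unfolding v_def by (metis (mono_tags, lifting) hd_dropWhile list.collapse)
  have CM: "\<exists>a b c m. u = a @ Semicolon # b @ Comma # c \<and> v = Bar # replicate m Mark \<and>
      Semicolon \<notin> set a \<and> Comma \<notin> set b" if CM_x: "x \<in> Conformant_Manipulation E"
  proof -
    obtain a b c m where abc: "x = (a @ Semicolon # b @ Comma # c) @ Bar # replicate m Mark"
      "Semicolon \<notin> set a" "Comma \<notin> set b" "Bar \<notin> set (a @ Semicolon # b @ Comma # c)"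
      by (rule Conformant_Manipulation_shape[OF CM_x])
    have "v \<noteq> []" using abc(1) Bar_u x by auto
    then obtain r where "v = Bar # r" using v by blast
    then show ?thesis
      using append_Cons_eq_first[OF Bar_u abc(4)] abc x by metis
  qed
  show ?thesis
  proof (cases rule: split_at_first[of Semicolon u])
    \<comment> \<open>No \<open>Semicolon\<close> before the first \<open>Bar\<close>: the machine
      stops in \<open>copy_cands\<close> and that \<open>Bar\<close> is not copied.\<close>
    case 1
    have "reaches reduction_tm (length u + 1) ?init
        (halted, [tape_at u v, tape_at [] [], tape_at [] [], tape_at u []])"
      unfolding init_reduction_tm x
      by (rule reaches_trans[OF run_copy_cands[OF 1 Bar_u, of "[]" _ _ _ "[]", simplified]
          reaches_one]) (use v in auto)
    then have "?ok u"
      by (rule halt_early[OF _ early]) (use count_u CM 1 in auto)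
    then show ?thesis ..
  next
    case (2 a u')
    note a = this
    show ?thesis
    proof (cases rule: split_at_first[of Comma u'])
      \<comment> \<open>No \<open>Comma\<close> after the first \<open>Semicolon\<close>: the
        machine stops in \<open>copy_pref\<close>, again without copying a
        \<open>Bar\<close>.\<close>
      case 1
      have "reaches reduction_tm (length a + 1 + (length u' + 1)) ?init
          (halted, [tape_at ((a @ [Semicolon]) @ u') v, tape_at [] [], tape_at [] [],
             tape_at ((a @ [Semicolon]) @ u') []])"
        unfolding x a(1) append_assoc append_Cons
        by (rule reaches_trans[OF run_copy_header reaches_trans[OF run_copy_pref reaches_one]])
          (use a Bar_u v 1 in auto)
      then have run: "reaches reduction_tm (length u + 1) ?init
          (halted, [tape_at u v, tape_at [] [], tape_at [] [], tape_at u []])"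
        using a by simp
      have "x \<notin> Conformant_Manipulation E"
        using CM a 1 append_Cons_eq_first[of Semicolon a] by fastforce
      then have "?ok u"
        using halt_early[OF run early] count_u by simp
      then show ?thesis ..
    next
      case (2 b c)
      then have u: "u = a @ Semicolon # b @ Comma # c" and ab: "Semicolon \<notin> set a" "Comma \<notin> set b"
        using a by simp_all
      note abc = ab Bar_u[unfolded u]
      show ?thesis
      proof (cases "v = []")
        \<comment> \<open>The header is complete but no \<open>Bar\<close> follows: the machine
          stops in \<open>copy_votes\<close>.\<close>
        case True
        have "reaches reduction_tm (length u + 1) ?init
            (halted, [tape_at u v, tape_at c [], tape_at [] [], tape_at u []])"
          unfolding x u by (rule reaches_trans[OF run_copy_all[OF abc] reaches_one]) (simp add: True)
        then have "?ok u"
          by (rule halt_early[OF _ early]) (use count_u CM True in auto)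
        then show ?thesis ..
      next
        case False
        then obtain r where r: "v = Bar # r" using v by blast
        define m where "m = length (takeWhile (\<lambda>l. l = Mark) r)"
        define s where "s = dropWhile (\<lambda>l. l = Mark) r"
        have rs: "r = replicate m Mark @ s"
        proof -
          have "takeWhile (\<lambda>l. l = Mark) r = replicate m Mark"
            unfolding m_def by (metis (mono_tags, lifting) replicate_length_same set_takeWhileD)
          then show ?thesis unfolding s_def by (metis takeWhile_dropWhile_id)
        qed
        have x': "x = u @ Bar # replicate m Mark @ s" by (simp add: x r rs)
        let ?n = "length u + 1 + m * (2 * length c + 2 * m + 5)"
        let ?y = "u @ Bar # concat (replicate m c)"
        have run: "reaches reduction_tm ?n ?init
            (read_mark, [tape_at (u @ Bar # replicate m Mark) s, tape_at c [],
               tape_at [] (map Bit (binary m)), tape_at ?y []])"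
          unfolding x' u by (rule run_all_marks[OF abc])
        have time: "?n + Suc (Suc m) \<le> ?b"
        proof -
          have "m * (2 * length c + 2 * m + 5) \<le> length x * (2 * length x + 5)"
            by (rule mult_mono) (simp_all add: x' u)
          moreover have "length u + 1 + m \<le> length x" by (simp add: x')
          ultimately show ?thesis by (simp add: algebra_simps)
        qed
        have count_y: "count_list ?y Bar = 1"
        proof -
          have "Bar \<notin> set (concat (replicate m c))" using abc(3) by auto
          then show ?thesis using count_u by (simp add: count_list_0_iff)
        qed
        show ?thesis
        proof (cases s)
          \<comment> \<open>Another letter follows the marks: the machine stops in
            \<open>read_mark\<close> with a single \<open>Bar\<close> written.\<close>
          case (Cons z s')
          have "z \<noteq> Mark"
            using Cons unfolding s_def by (metis (mono_tags, lifting) dropWhile_eq_Cons_conv)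
          have "reaches reduction_tm (?n + 1) ?init
              (halted, [tape_at (u @ Bar # replicate m Mark) s, tape_at c [],
                 tape_at [] (map Bit (binary m)), tape_at ?y []])"
            by (rule reaches_trans[OF run reaches_one]) (use \<open>z \<noteq> Mark\<close> Cons in simp)
          moreover have "x \<notin> Conformant_Manipulation E"
          proof
            assume "x \<in> Conformant_Manipulation E"
            then obtain m' where "v = Bar # replicate m' Mark" using CM by blast
            then have "set s \<subseteq> {Mark}" using r rs
              by (metis Un_subset_iff list.inject set_append set_replicate_conv_if subset_singletonD
                  empty_subsetI order_refl)
            then show False using Cons \<open>z \<noteq> Mark\<close> by simp
          qed
          ultimately have "?ok ?y"
            using halt_early[of "?n + 1"] time count_y by simp
          then show ?thesis ..
        next
          case Nil
          let ?z = "?y @ Bar # enc_nat m"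
          \<comment> \<open>The two extra steps write the second \<open>Bar\<close> and the closing
            \<open>Comma\<close>.\<close>
          have "reaches reduction_tm (?n + Suc (Suc (length (binary m)))) ?init
              (halted, [tape_at (u @ Bar # replicate m Mark) s, tape_at c [],
                 tape_at (map Bit (binary m)) [], tape_at ((?y @ [Bar]) @ map Bit (binary m) @ [Comma]) []])"
            by (rule reaches_trans[OF run reaches_Suc])
              (use run_paste_counter[of "map Bit (binary m)" _ _ "[]" "?y @ [Bar]"] Nil in simp_all)
          then have "reaches reduction_tm ?b ?init
              (halted, [tape_at (u @ Bar # replicate m Mark) s, tape_at c [],
                 tape_at (map Bit (binary m)) [], tape_at ?z []])"
            using time length_binary[of m] by (auto simp: enc_nat_def elim!: reaches_mono)
          then have "outputs_within reduction_tm x ?z ?b"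
            by (rule reaches_halted_outputs_within)
          moreover have "x \<in> Conformant_Manipulation E \<longleftrightarrow> ?z \<in> Exact_Control_Adding_Voters E"
            using reduction_correct[OF abc, of m E] by (simp add: x' u Nil)
          ultimately show ?thesis by blast
        qed
      qed
    qed
  qed
qed

theorem theorem3:
  fixes E :: "nat set \<Rightarrow> nat rel multiset \<Rightarrow> nat set"
  assumes "voting_rule E"
  shows "Conformant_Manipulation E \<le>\<^sub>p Exact_Control_Adding_Voters E"
proof -
  have "\<forall>x. \<exists>y. outputs_within reduction_tm x y (poly [:2, 7, 2:] (length x)) \<and>
      (x \<in> Conformant_Manipulation E \<longleftrightarrow> y \<in> Exact_Control_Adding_Voters E)"
    using reduction_run by blast
  \<comment> \<open>Choice only names the outputs: machine and polynomial are the same for all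
    \<open>x\<close>, so \<open>f\<close> is computable.\<close>
  from choice[OF this] obtain f where "\<forall>x. outputs_within reduction_tm x (f x) (poly [:2, 7, 2:] (length x)) \<and>
      (x \<in> Conformant_Manipulation E \<longleftrightarrow> f x \<in> Exact_Control_Adding_Voters E)"
    by blast
  then show ?thesis
    unfolding poly_time_reducible_def poly_time_computable_def using wf_reduction_tm by blast
qed

end
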